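(* Let $T=\mathrm{diag}(b(v_1,v_1),\dots,b(v_m,v_m))$ be the diagonal matrix of the Hermitian form $b$ in an orthogonal basis normalized so that $|b(v_i,v_i)|=q$ for $1\le i\le k$ and $|b(v_i,v_i)|=1$ for $k<i\le m$. Let $\mathfrak g$ be the realization of $\mathfrak u_m$ given by $$\mathfrak g=\{xw_mT\;:\;x\in\mathfrak{gl}_m(E)\text{ and }(xw_m)^*=-xw_m\}.$$ Let $n>v_E(2)$ be an integer. Then there is no $X\in\mathfrak g$ such that $X-I_m\in\mathfrak{gl}_m(\mathscr P_E^n)$.
   Context: $E$ is a non-archimedean local field of characteristic $0$ with a non-trivial involution $\theta$ and fixed field $F$ (so $[E:F]=2$); $\mathscr O_E$ is its ring of integers, $\mathscr P_E$ the prime ideal, $v_E$ the normalized valuation. $b$ is a non-degenerate sesquilinear form on an $m$-dimensional $E$-vector space $V$ with $\theta(b(v,u))=b(u,v)$, and $v_1,\dots,v_m$ is an orthogonal $E$-basis of $V$, so the entries of $T$ lie in $F^\times$. $|\cdot|$ is the normalized absolute value and $q$ the cardinality of the residue field; $0\le k\le m$. $w_m$ is the $m\times m$ matrix with $1$'s on the antidiagonal and $0$ elsewhere; for a matrix $x$ over $E$, $x^*={}^t\theta(x)$ is the conjugate transpose. *)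

theory Defs
  imports Complex_Main "Jordan_Normal_Form.Matrix"
begin

text \<open>A discrete valuation on a field is given as an integer-valued function; its value at \<open>0\<close>
  (mathematically \<open>+\<infinity>\<close>) is left unspecified and never used.\<close>

definition fractional_ideal_power :: "('e::field \<Rightarrow> int) \<Rightarrow> int \<Rightarrow> 'e set" where
  "fractional_ideal_power v n = {x. x = 0 \<or> n \<le> v x}"

abbreviation integer_ring :: "('e::field \<Rightarrow> int) \<Rightarrow> 'e set" where
  "integer_ring v \<equiv> fractional_ideal_power v 0"

abbreviation prime_ideal :: "('e::field \<Rightarrow> int) \<Rightarrow> 'e set" where
  "prime_ideal v \<equiv> fractional_ideal_power v 1"

definition residue_field :: "('e::field \<Rightarrow> int) \<Rightarrow> 'e set set" where
  "residue_field v = integer_ring v //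
     {(x, y). x \<in> integer_ring v \<and> y \<in> integer_ring v \<and> x - y \<in> prime_ideal v}"

text \<open>A non-archimedean local field: complete with respect to a normalized discrete valuation \<open>v\<close>,
  with finite residue field.\<close>

locale nonarch_local_field =
  fixes v :: "'e::field \<Rightarrow> int"
  assumes v_mult: "\<lbrakk>x \<noteq> 0; y \<noteq> 0\<rbrakk> \<Longrightarrow> v (x * y) = v x + v y"
    and v_add: "\<lbrakk>x \<noteq> 0; y \<noteq> 0; x + y \<noteq> 0\<rbrakk> \<Longrightarrow> min (v x) (v y) \<le> v (x + y)"
    and v_normalized: "v ` (UNIV - {0}) = UNIV"
    and complete: "(\<And>n. \<exists>N. \<forall>i\<ge>N. \<forall>j\<ge>N. s i - s j \<in> fractional_ideal_power v n) \<Longrightarrow>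
      \<exists>l. \<forall>n. \<exists>N. \<forall>i\<ge>N. s (i::nat) - l \<in> fractional_ideal_power v n"
    and finite_residue_field: "finite (residue_field v)"

definition normalized_abs :: "('e::field \<Rightarrow> int) \<Rightarrow> 'e \<Rightarrow> real" where
  "normalized_abs v x = (if x = 0 then 0 else real (card (residue_field v)) powi (- v x))"

text \<open>Continuity of \<open>\<theta>\<close> is not imposed: every automorphism of a local field preserves the
  valuation.\<close>

locale nontrivial_involution = field_hom \<theta> for \<theta> :: "'e::field \<Rightarrow> 'e" +
  assumes involutive: "\<theta> (\<theta> x) = x"
    and nontrivial: "\<exists>x. \<theta> x \<noteq> x"

text \<open>Linearity is in the first variable, conjugate-linearity in the second.\<close>

locale hermitian_space = vector_space scale + nontrivial_involution \<theta>
  for scale :: "'e::field \<Rightarrow> 'a::ab_group_add \<Rightarrow> 'a" and \<theta> :: "'e \<Rightarrow> 'e" +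
  fixes b :: "'a \<Rightarrow> 'a \<Rightarrow> 'e"
  assumes form_add_left: "b (x + y) z = b x z + b y z"
    and form_add_right: "b x (y + z) = b x y + b x z"
    and form_scale_left: "b (scale c x) y = c * b x y"
    and form_scale_right: "b x (scale c y) = \<theta> c * b x y"
    and form_hermitian: "\<theta> (b y x) = b x y"
    and form_nondegenerate: "(\<And>y. b x y = 0) \<Longrightarrow> x = 0"
begin

text \<open>The basis vectors are indexed by \<open>0, \<dots>, m - 1\<close>.\<close>

definition orthogonal_basis :: "nat \<Rightarrow> (nat \<Rightarrow> 'a) \<Rightarrow> bool" where
  "orthogonal_basis m u \<longleftrightarrow>
     inj_on u {..<m} \<and> independent (u ` {..<m}) \<and> span (u ` {..<m}) = UNIV \<and>
     (\<forall>i<m. \<forall>j<m. i \<noteq> j \<longrightarrow> b (u i) (u j) = 0)"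

end

definition antidiagonal_mat :: "nat \<Rightarrow> 'e::field mat" where
  "antidiagonal_mat m = mat m m (\<lambda>(i, j). if i + j + 1 = m then 1 else 0)"

definition conj_transpose :: "('e \<Rightarrow> 'e) \<Rightarrow> 'e mat \<Rightarrow> 'e mat" where
  "conj_transpose \<theta> x = transpose_mat (map_mat \<theta> x)"

definition unitary_lie_algebra :: "nat \<Rightarrow> ('e \<Rightarrow> 'e) \<Rightarrow> 'e::field mat \<Rightarrow> 'e mat set" where
  "unitary_lie_algebra m \<theta> T =
     {x * antidiagonal_mat m * T | x. x \<in> carrier_mat m m \<and>
        conj_transpose \<theta> (x * antidiagonal_mat m) = - (x * antidiagonal_mat m)}"

end

theory Submission
  imports Defs
begin

text \<open>A diagonal entry \<open>x\<close> of an element of \<open>\<gg>\<close> satisfies \<open>\<theta> x = - x\<close>, because \<open>T\<close> is diagonal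
  with entries fixed by \<open>\<theta>\<close>. If \<open>a = x - 1\<close> lies in \<open>P\<^sup>n\<close>, then so does \<open>\<theta> a\<close>, hence also
  \<open>a + \<theta> a = - 2\<close>, contradicting \<open>v 2 < n\<close>.

  That \<open>\<theta>\<close> preserves the valuation is automatic: choose \<open>r\<close> in the prime ideal with \<open>v (\<theta> r)\<close> odd.
  By completeness \<open>1 + 4 r x\<^sup>2\<close> is a square for every integral \<open>x\<close>, so its image is a square too and
  has even valuation. This forces \<open>v (4 \<theta> r (\<theta> x)\<^sup>2) \<ge> 0\<close>, so \<open>v \<circ> \<theta>\<close> is bounded
  below on the ring of integers. Applied to powers of units and of a uniformizer, this makes
  \<open>v \<circ> \<theta>\<close> a nonnegative multiple of \<open>v\<close>, and surjectivity makes the factor \<open>1\<close>.\<close>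

context nonarch_local_field
begin

section \<open>Arithmetic of the valuation and of the powers of the prime ideal\<close>

abbreviation ideal_power :: "int \<Rightarrow> 'e set" where
  "ideal_power \<equiv> fractional_ideal_power v"

lemma v_one [simp]: "v 1 = 0"
  using v_mult[of 1 1] by simp

lemma v_minus_one [simp]: "v (- 1) = 0"
  using v_mult[of "- 1" "- 1"] by simp

lemma v_uminus [simp]: "v (- x) = v x"
  using v_mult[of "- 1" x] by (cases "x = 0") auto

lemma v_power: "x \<noteq> 0 \<Longrightarrow> v (x ^ i) = int i * v x"
  by (induction i) (auto simp: v_mult algebra_simps)

lemma v_inverse: "x \<noteq> 0 \<Longrightarrow> v (inverse x) = - v x"
  using v_mult[of x "inverse x"] by simp

lemma v_power_int: "x \<noteq> 0 \<Longrightarrow> v (x powi i) = i * v x"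
  by (cases i rule: int_cases4) (auto simp: v_power v_inverse power_int_minus)

lemma exists_valuation: "\<exists>x. x \<noteq> 0 \<and> v x = i"
proof -
  have "i \<in> v ` (UNIV - {0})" by (simp add: v_normalized)
  then show ?thesis by auto
qed

lemma ideal_power_iff: "x \<in> ideal_power n \<longleftrightarrow> x = 0 \<or> n \<le> v x"
  by (simp add: fractional_ideal_power_def)

lemma ideal_power_mono: "x \<in> ideal_power n \<Longrightarrow> l \<le> n \<Longrightarrow> x \<in> ideal_power l"
  by (auto simp: ideal_power_iff)

lemma ideal_power_add: "x \<in> ideal_power n \<Longrightarrow> y \<in> ideal_power n \<Longrightarrow> x + y \<in> ideal_power n"
  using v_add[of x y] by (fastforce simp: ideal_power_iff)

lemma ideal_power_uminus: "x \<in> ideal_power n \<Longrightarrow> - x \<in> ideal_power n"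
  by (auto simp: ideal_power_iff)

lemma ideal_power_diff: "x \<in> ideal_power n \<Longrightarrow> y \<in> ideal_power n \<Longrightarrow> x - y \<in> ideal_power n"
  using ideal_power_add[of x n "- y"] ideal_power_uminus[of y n] by simp

lemma ideal_power_mult:
  "x \<in> ideal_power n \<Longrightarrow> y \<in> ideal_power l \<Longrightarrow> x * y \<in> ideal_power (n + l)"
  by (cases "x = 0 \<or> y = 0") (auto simp: ideal_power_iff v_mult)

lemma zero_if_in_all_ideal_powers:
  assumes "\<And>n::nat. x \<in> ideal_power (int n)"
  shows "x = 0"
  \<comment> \<open>For nonzero \<open>x\<close> the instance \<open>0\<close> gives
    \<open>0 \<le> v x\<close>, so \<open>nat\<close> does not truncate in the other
    instance.\<close>
  using assms[of "nat (v x + 1)"] assms[of 0] by (auto simp: ideal_power_iff)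

text \<open>Writing \<open>x = (x + y) - y\<close> gives the reverse of the ultrametric inequality.
  The case \<open>y = 0\<close> is separate because \<open>v 0\<close> carries no meaning.\<close>

lemma v_add_eq_if_less:
  assumes "x \<noteq> 0" "y = 0 \<or> v x < v y"
  shows "v (x + y) = v x"
proof (cases "y = 0")
  case False
  then have less: "v x < v y" using assms by simp
  have "x + y \<noteq> 0"
    using less v_uminus[of y] by (auto simp: eq_neg_iff_add_eq_0[symmetric])
  then show ?thesis
    using v_add[of x y] v_add[of "x + y" "- y"] assms False less by auto
qed simp

section \<open>Square roots from completeness\<close>

text \<open>The map \<open>y \<mapsto> z - y\<^sup>2\<close> preserves the prime ideal and contracts
  it: a difference of two squares has the sum of the two elements as a factor, which gains one power
  of the ideal. Its iterates from \<open>0\<close> converge to the root.\<close>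

lemma ex_root_quadratic:
  assumes z: "z \<in> ideal_power 1"
  shows "\<exists>y. y\<^sup>2 + y = z"
proof -
  define s where "s = rec_nat 0 (\<lambda>_ y. z - y\<^sup>2)"
  have s0: "s 0 = 0" and sSuc: "s (Suc i) = z - (s i)\<^sup>2" for i
    by (simp_all add: s_def)
  have s_in: "s i \<in> ideal_power 1" for i
  proof (induction i)
    case (Suc i)
    have "(s i)\<^sup>2 \<in> ideal_power 1"
      using ideal_power_mono[OF ideal_power_mult[OF Suc Suc], of 1] by (simp add: power2_eq_square)
    then show ?case unfolding sSuc by (rule ideal_power_diff[OF z])
  qed (simp add: s0 ideal_power_iff)
  have step: "s (Suc i) - s i \<in> ideal_power (int i + 1)" for i
  proof (induction i)
    case (Suc i)
    have "s (Suc (Suc i)) - s (Suc i) = - ((s (Suc i) - s i) * (s (Suc i) + s i))"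
      by (simp add: sSuc[of "Suc i"]) (simp add: sSuc power2_eq_square algebra_simps)
    moreover have "\<dots> \<in> ideal_power (int i + 1 + 1)"
      by (intro ideal_power_uminus ideal_power_mult ideal_power_add Suc s_in)
    ultimately show ?case by (simp only: of_nat_Suc add_ac)
  qed (use s_in[of 1] s0 in simp)
  have from_start: "s (N + d) - s N \<in> ideal_power (int N)" for N d
  proof (induction d)
    case (Suc d)
    show ?case
      using ideal_power_add[OF ideal_power_mono[OF step[of "N + d"], of "int N"] Suc] by simp
  qed (simp add: ideal_power_iff)
  have cauchy: "\<exists>N. \<forall>i\<ge>N. \<forall>j\<ge>N. s i - s j \<in> ideal_power n" for n
  \<comment> \<open>For negative \<open>n\<close> the index becomes \<open>0\<close>, which suffices
    since the ideal powers decrease.\<close>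
  proof (intro exI[of _ "nat n"] allI impI)
    fix i j assume "nat n \<le> i" "nat n \<le> j"
    then have "s i - s (nat n) \<in> ideal_power (int (nat n))"
      "s j - s (nat n) \<in> ideal_power (int (nat n))"
      using from_start[of "nat n" "i - nat n"] from_start[of "nat n" "j - nat n"] by auto
    from ideal_power_diff[OF this] show "s i - s j \<in> ideal_power n"
      by (auto intro: ideal_power_mono)
  qed
  from complete[of s, OF cauchy] obtain y where
    y: "\<exists>N. \<forall>i\<ge>N. s i - y \<in> ideal_power n" for n by blast
  have y_in: "y \<in> ideal_power 1"
  proof -
    obtain i where "s i - y \<in> ideal_power 1" using y[of 1] by blast
    from ideal_power_diff[OF s_in[of i] this] show ?thesis by simp
  qed
  \<comment> \<open>The residual is expressed through the errors of two consecutive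
    iterates.\<close>
  have "y\<^sup>2 + y - z \<in> ideal_power (int n)" for n
  proof -
    obtain N where N: "\<forall>i\<ge>N. s i - y \<in> ideal_power (int n)" using y by blast
    have "(s N - y) * (s N + y) \<in> ideal_power (int n + 1)"
      using N by (intro ideal_power_mult ideal_power_add s_in y_in) auto
    then have "(s N - y) * (s N + y) \<in> ideal_power (int n)"
      by (rule ideal_power_mono) simp
    moreover have "s (Suc N) - y \<in> ideal_power (int n)"
      using N by simp
    ultimately have "- ((s N - y) * (s N + y) + (s (Suc N) - y)) \<in> ideal_power (int n)"
      by (intro ideal_power_uminus ideal_power_add)
    then show ?thesis by (simp add: sSuc power2_eq_square algebra_simps)
  qed
  then have "y\<^sup>2 + y - z = 0" by (rule zero_if_in_all_ideal_powers)
  then show ?thesis by auto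
qed

text \<open>Completing the square without dividing by 2, so that residue characteristic 2 is
  covered.\<close>

lemma ex_sqrt_one_plus_four_mult:
  assumes "z \<in> ideal_power 1"
  shows "\<exists>y. y\<^sup>2 = 1 + 4 * z"
proof -
  obtain y where "y\<^sup>2 + y = z" using ex_root_quadratic[OF assms] by blast
  moreover have "(1 + 2 * y)\<^sup>2 = 1 + 4 * (y\<^sup>2 + y)" by (simp add: power2_eq_square algebra_simps)
  ultimately have "(1 + 2 * y)\<^sup>2 = 1 + 4 * z" by simp
  then show ?thesis by blast
qed

section \<open>Automatic invariance of the valuation\<close>

lemma nonneg_if_multiples_bounded_below:
  fixes c C :: int
  assumes "\<And>i::nat. C \<le> int i * c"
  shows "0 \<le> c"
proof (rule ccontr)
  assume "\<not> 0 \<le> c"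
  \<comment> \<open>The instance \<open>0\<close> gives \<open>C \<le> 0\<close>, so this multiple
    is at most \<open>C - 1\<close>.\<close>
  then have "int (nat (- C + 1)) * c \<le> int (nat (- C + 1)) * (- 1)"
    by (intro mult_left_mono) auto
  then show False using assms[of "nat (- C + 1)"] assms[of 0] by auto
qed

lemma surj_field_hom_bounded_below:
  assumes "field_hom \<phi>" and "surj \<phi>" and two: "(2::'e) \<noteq> 0"
  shows "\<exists>C. \<forall>x. x \<noteq> 0 \<longrightarrow> 0 \<le> v x \<longrightarrow> C \<le> v (\<phi> x)"
proof -
  interpret field_hom \<phi> by fact
  have four: "(4::'e) \<noteq> 0"
    using two mult_eq_0_iff[of "2::'e" 2] by simp
  obtain p where p: "p \<noteq> 0" "v p = 1" using exists_valuation by blast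
  obtain r0 where r0: "\<phi> r0 = p" using \<open>surj \<phi>\<close> by (metis surjD)
  then have r0_nz: "r0 \<noteq> 0" using p by auto
  \<comment> \<open>Multiplying by \<open>c\<^sup>2\<close> moves \<open>r0\<close> into the prime
    ideal and keeps the parity of the valuation of its image.\<close>
  obtain c where c: "c \<noteq> 0" "v c = \<bar>v r0\<bar> + 1" using exists_valuation by blast
  define r where "r = r0 * c\<^sup>2"
  have r: "r \<noteq> 0" "1 \<le> v r" "odd (v (\<phi> r))"
    using r0_nz c p by (auto simp: r_def v_mult v_power hom_mult hom_power r0)
  have "- v 4 - v (\<phi> r) \<le> 2 * v (\<phi> x)" if x: "x \<noteq> 0" "0 \<le> v x" for x
  proof (rule ccontr)
    assume "\<not> ?thesis"
    moreover define w where "w = 4 * (\<phi> r * (\<phi> x)\<^sup>2)"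
    moreover have v4: "v (4::'e) = 2 * v 2" using v_mult[of 2 2] two by simp
    ultimately have w: "w \<noteq> 0" "v w < 0" "odd (v w)"
      using four r x by (auto simp: v_mult v_power)
    have "r * x\<^sup>2 \<in> ideal_power 1"
      using r x by (auto simp: ideal_power_iff v_mult v_power)
    then obtain y where "y\<^sup>2 = 1 + 4 * (r * x\<^sup>2)"
      using ex_sqrt_one_plus_four_mult by blast
    then have "\<phi> (y\<^sup>2) = \<phi> (1 + (2 * 2) * (r * x\<^sup>2))" by simp
    then have "(\<phi> y)\<^sup>2 = 1 + (\<phi> 2 * \<phi> 2) * (\<phi> r * (\<phi> x)\<^sup>2)"
      by (simp only: hom_mult hom_power hom_add hom_one)
    moreover have "\<phi> 2 = 2" using hom_add[of 1 1] by simp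
    ultimately have sq: "(\<phi> y)\<^sup>2 = w + 1" by (simp add: w_def)
    \<comment> \<open>The term \<open>w\<close> dominates 1, so the square of
      \<open>\<phi> y\<close> would have odd valuation.\<close>
    have "v (w + 1) = v w" by (rule v_add_eq_if_less) (use w in auto)
    moreover have "w \<noteq> - 1" using w by auto
    then have "\<phi> y \<noteq> 0" using sq by (auto simp: eq_neg_iff_add_eq_0)
    ultimately show False using w sq v_power[of "\<phi> y" 2] by auto
  qed
  then have "\<forall>x. x \<noteq> 0 \<longrightarrow> 0 \<le> v x \<longrightarrow> (- v 4 - v (\<phi> r)) div 2 \<le> v (\<phi> x)"
    by fastforce
  then show ?thesis by blast
qed

theorem valuation_surj_field_hom:
  assumes "field_hom \<phi>" and "surj \<phi>" and two: "(2::'e) \<noteq> 0"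
  shows "v (\<phi> x) = v x"
proof (cases "x = 0")
  case False
  interpret field_hom \<phi> by fact
  obtain C where C: "\<And>x. x \<noteq> 0 \<Longrightarrow> 0 \<le> v x \<Longrightarrow> C \<le> v (\<phi> x)"
    using surj_field_hom_bounded_below[OF assms] by blast
  have nonneg: "0 \<le> v (\<phi> x)" if "x \<noteq> 0" "0 \<le> v x" for x
  \<comment> \<open>Powers of \<open>x\<close> stay integral, so \<open>C\<close> bounds every
    multiple of \<open>v (\<phi> x)\<close>.\<close>
  proof (rule nonneg_if_multiples_bounded_below)
    show "C \<le> int i * v (\<phi> x)" for i
      using C[of "x ^ i"] that by (simp add: v_power hom_power)
  qed
  have unit: "v (\<phi> x) = 0" if "x \<noteq> 0" "v x = 0" for x
  proof -
    have "x * inverse x = 1" using that by simp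
    then have "\<phi> x * \<phi> (inverse x) = 1" by (metis hom_mult hom_one)
    then have "v (\<phi> x) + v (\<phi> (inverse x)) = 0"
      using v_mult[of "\<phi> x" "\<phi> (inverse x)"] that by auto
    then show ?thesis using nonneg[of x] nonneg[of "inverse x"] that by (simp add: v_inverse)
  qed
  obtain p where p: "p \<noteq> 0" "v p = 1" using exists_valuation by blast
  have scaled: "v (\<phi> x) = v x * v (\<phi> p)" if x: "x \<noteq> 0" for x
  proof -
    \<comment> \<open>The unit part of \<open>x\<close> with respect to the uniformizer
      \<open>p\<close>.\<close>
    define y where "y = x * p powi (- v x)"
    have y: "y \<noteq> 0" "v y = 0" using x p by (auto simp: y_def v_mult v_power_int)
    have "v (\<phi> y) = v (\<phi> x) + - v x * v (\<phi> p)"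
    proof -
      have "\<phi> (p powi i) = \<phi> p powi i" for i
        by (cases i rule: int_cases4) (auto simp: power_int_minus hom_power hom_inverse)
      then show ?thesis using x p by (simp add: y_def hom_mult v_mult v_power_int)
    qed
    then show ?thesis using unit[OF y] by simp
  qed
  obtain z where z: "\<phi> z = p" using \<open>surj \<phi>\<close> by (metis surjD)
  then have "v z * v (\<phi> p) = 1" using scaled[of z] p by auto
  moreover have "0 \<le> v (\<phi> p)" using nonneg[of p] p by simp
  ultimately have "v (\<phi> p) = 1" by (metis abs_of_nonneg dvd_triv_right zdvd1_eq)
  then show ?thesis using scaled[OF False] by simp
next
  case True
  interpret field_hom \<phi> by fact
  \<comment> \<open>Both sides are the same unspecified value \<open>v 0\<close>.\<close>
  show ?thesis using True by simp
qed

end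

section \<open>Diagonal entries and the contradiction\<close>

text \<open>Transposition fixes the diagonal, so skewness reads \<open>\<theta> y = - y\<close> on
  diagonal entries; right multiplication by the diagonal matrix only scales them by fixed
  elements.\<close>

lemma unitary_lie_algebra_diagonal_entry:
  assumes "field_hom \<theta>" and fixed: "\<And>i. i < m \<Longrightarrow> \<theta> (t i) = t i"
    and X: "X \<in> unitary_lie_algebra m \<theta> (mat_diag m t)" and i: "i < m"
  shows "\<theta> (X $$ (i, i)) = - (X $$ (i, i))"
proof -
  interpret field_hom \<theta> by fact
  from X obtain x where x: "x \<in> carrier_mat m m"
    and skew: "conj_transpose \<theta> (x * antidiagonal_mat m) = - (x * antidiagonal_mat m)"
    and X_eq: "X = x * antidiagonal_mat m * mat_diag m t"
    unfolding unitary_lie_algebra_def by blast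
  define Y where "Y = x * antidiagonal_mat m"
  have Y: "Y \<in> carrier_mat m m" using x by (simp add: Y_def antidiagonal_mat_def)
  have "X $$ (i, i) = Y $$ (i, i) * t i"
    using i by (simp add: X_eq flip: Y_def) (simp add: mat_diag_mult_right[OF Y])
  moreover have "\<theta> (Y $$ (i, i)) = - (Y $$ (i, i))"
    using arg_cong[OF skew, of "\<lambda>A. A $$ (i, i)"] Y i
    by (simp add: conj_transpose_def flip: Y_def)
  ultimately show ?thesis using fixed[OF i] by (simp add: hom_mult)
qed

theorem proposition0p5p8:
  fixes v :: "'e::field_char_0 \<Rightarrow> int"
    and \<theta> :: "'e \<Rightarrow> 'e"
    and scale :: "'e \<Rightarrow> 'a::ab_group_add \<Rightarrow> 'a"
    and b :: "'a \<Rightarrow> 'a \<Rightarrow> 'e"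
    and u :: "nat \<Rightarrow> 'a"
    and m k :: nat
    and n :: int
    and T :: "'e mat"
  assumes "nonarch_local_field v"
    and "hermitian_space scale \<theta> b"
    and "1 \<le> m" and "k \<le> m"
    and "hermitian_space.orthogonal_basis scale b m u"
    and "\<And>i. i < k \<Longrightarrow> normalized_abs v (b (u i) (u i)) = real (card (residue_field v))"
    and "\<And>i. k \<le> i \<Longrightarrow> i < m \<Longrightarrow> normalized_abs v (b (u i) (u i)) = 1"
    and "T = mat_diag m (\<lambda>i. b (u i) (u i))"
    and "v 2 < n"
  shows "\<not> (\<exists>X \<in> unitary_lie_algebra m \<theta> T.
    X - 1\<^sub>m m \<in> carrier_mat m m \<and> elements_mat (X - 1\<^sub>m m) \<subseteq> fractional_ideal_power v n)"
proof
  assume "\<exists>X \<in> unitary_lie_algebra m \<theta> T.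
    X - 1\<^sub>m m \<in> carrier_mat m m \<and> elements_mat (X - 1\<^sub>m m) \<subseteq> fractional_ideal_power v n"
  then obtain X where X: "X \<in> unitary_lie_algebra m \<theta> T"
    and carrier: "X - 1\<^sub>m m \<in> carrier_mat m m"
    and elements: "elements_mat (X - 1\<^sub>m m) \<subseteq> fractional_ideal_power v n" by blast
  interpret nonarch_local_field v by fact
  interpret hermitian_space scale \<theta> b by fact
  have "surj \<theta>" by (metis involutive surjI)
  then have v_\<theta>: "v (\<theta> x) = v x" for x
    by (intro valuation_surj_field_hom) (unfold_locales, simp_all)
  \<comment> \<open>Any diagonal entry would serve; this one exists because
    \<open>1 \<le> m\<close>.\<close>
  define a where "a = X $$ (0, 0) - 1"
  have m: "0 < m" using \<open>1 \<le> m\<close> by simp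
  have "\<theta> (X $$ (0, 0)) = - (X $$ (0, 0))"
    using X m form_hermitian unfolding \<open>T = _\<close>
    by (intro unitary_lie_algebra_diagonal_entry) (unfold_locales, auto)
  then have "a + \<theta> a = - 2" by (simp add: a_def hom_minus)
  moreover have a: "a \<in> ideal_power n"
  proof -
    have "(X - 1\<^sub>m m) $$ (0, 0) \<in> ideal_power n"
      using elements carrier m by (intro subsetD[OF elements] elements_matI) auto
    then show ?thesis using m by (simp add: a_def)
  qed
  moreover have "\<theta> a \<in> ideal_power n"
    using a by (auto simp: ideal_power_iff v_\<theta>)
  ultimately have "- 2 \<in> ideal_power n" by (metis ideal_power_add)
  \<comment> \<open>In characteristic 0 the element \<open>- 2\<close> is nonzero, and its valuation
    is \<open>v 2\<close>.\<close>
  then show False using \<open>v 2 < n\<close> by (simp add: ideal_power_iff)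
qed

end
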